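(* In the range $n<m-1$, the following statements hold. (1) For $n=1$, the Ehrhart polynomial $i(\mathcal{P}(m,1),t)$ is not magic positive for every integer $m\ge 3$. (2) For $n=2$, the Ehrhart polynomial $i(\mathcal{P}(m,2),t)$ is not magic positive for every integer $m\ge 4$. (3) For $n=3$ (so $m\ge 5$), the Ehrhart polynomial $i(\mathcal{P}(m,3),t)$ is magic positive exactly for $m=5$ and $m=6$; it is not magic positive for every integer $m\ge 7$.
   Context: For positive integers $m,n$, the partial permutohedron $\mathcal{P}(m,n)\subset\mathbb{R}^m$ is the convex hull of all vectors in $\{0,1,\ldots,n\}^m$ whose nonzero entries are pairwise distinct. It is an $m$-dimensional lattice polytope. For a lattice polytope $\mathcal{P}\subset\mathbb{R}^N$ of dimension $d$, the Ehrhart polynomial $i(\mathcal{P},t)$ is the polynomial in $t$ (of degree $d$) satisfying $i(\mathcal{P},t)=|t\mathcal{P}\cap\mathbb{Z}^N|$ for all positive integers $t$. It is called magic positive if $i(\mathcal{P},t)=\sum_{i=0}^d a_i\,t^i(t+1)^{d-i}$ with $a_i\ge 0$ for all $0\le i\le d$. *)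

theory Defs
  imports "HOL-Analysis.Analysis" "HOL-Computational_Algebra.Polynomial"
begin

text \<open>The dimension \<open>m\<close> of the ambient space is the cardinality of the index type \<open>'m\<close>.\<close>

definition partial_permutohedron :: "nat \<Rightarrow> (real ^ 'm) set" where
  "partial_permutohedron n =
     convex hull {x. (\<forall>i. x $ i \<in> real ` {0..n}) \<and>
                     (\<forall>i j. i \<noteq> j \<and> x $ i \<noteq> 0 \<and> x $ j \<noteq> 0 \<longrightarrow> x $ i \<noteq> x $ j)}"

definition lattice_points :: "(real ^ 'm) set" where
  "lattice_points = {x. \<forall>i. x $ i \<in> \<int>}"

text \<open>A polynomial is determined by its values at the positive integers, so the description below
  is unique; existence for lattice polytopes is Ehrhart's theorem, and that the degree is the
  dimension of \<open>P\<close> is then a consequence.\<close>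

definition ehrhart_polynomial :: "(real ^ 'm) set \<Rightarrow> real poly" where
  "ehrhart_polynomial P =
     (THE p. \<forall>t::nat. t > 0 \<longrightarrow>
        poly p (real t) = real (card ((\<lambda>x. real t *\<^sub>R x) ` P \<inter> lattice_points)))"

text \<open>\<open>[:0, 1:]\<close> is the variable \<open>t\<close> and \<open>[:1, 1:]\<close> is \<open>t + 1\<close>.\<close>

definition ehrhart_magic_positive :: "(real ^ 'm) set \<Rightarrow> bool" where
  "ehrhart_magic_positive P \<longleftrightarrow>
     (let d = nat (aff_dim P) in
      \<exists>a :: nat \<Rightarrow> real. (\<forall>i\<le>d. a i \<ge> 0) \<and>
        ehrhart_polynomial P = (\<Sum>i\<le>d. smult (a i) ([:0, 1:] ^ i * [:1, 1:] ^ (d - i))))"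

end

theory Submission
  imports Defs
begin

text \<open>For \<open>n \<le> 3\<close> and \<open>m \<ge> 3\<close> the partial permutohedron is cut out of the nonnegative orthant by bounds
on one entry, on the sum of two entries and on the sum of all entries
(\<open>partial_permutohedron_eq_system\<close>); this is the greedy algorithm together with a separating
hyperplane. In the dilate by \<open>t\<close>, an integer point that respects the bound on the total violates
at most one other constraint, so the lattice points are the points of a simplex minus disjoint
families that are counted directly. With rising factorials \<open>(x)\<^sub>m = x (x + 1) \<dots> (x + m - 1)\<close> the
Ehrhart polynomials times \<open>m!\<close> are
\<^item> \<open>(t + 1)\<^sub>m\<close> for \<open>n = 1\<close>,
\<^item> \<open>(3t + 1)\<^sub>m - m (t)\<^sub>m\<close> for \<open>n = 2\<close>,
\<^item> \<open>(6t + 1)\<^sub>m - m (3t)\<^sub>m - (m choose 2) (t)\<^sub>m\<^sub>-\<^sub>1 ((m - 1) t + 1)\<close> for \<open>n = 3\<close>.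

A magic positive polynomial of degree \<open>m\<close> has the weak sign \<open>(-1) ^ m\<close> at every \<open>t \<le> -1\<close>
(\<open>magic_positive_sign\<close>). In contrast, a rising factorial of \<open>t\<close> changes its sign at each of the
integers \<open>-1, -2, \<dots>\<close> in its range. For \<open>n = 2, 3\<close> and \<open>t\<close> equal to \<open>-4/3\<close> or \<open>-7/3\<close>, the
factorials of \<open>3t\<close>, \<open>3t + 1\<close> and \<open>6t + 1\<close> that occur vanish once \<open>m\<close> is large enough; what
remains is the last summand, whose sign at one of the two points is wrong for the parity of \<open>m\<close>.
For \<open>n = 1\<close> the points \<open>-3/2\<close> and \<open>-5/2\<close> do the same. The finitely many small \<open>m\<close> that escape
have a negative coefficient of \<open>t ^ 3 * (1 + t) ^ (m - 3)\<close> for \<open>n = 2\<close> or of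
\<open>t ^ 4 * (1 + t) ^ (m - 4)\<close> for \<open>n = 3\<close>, computed by
\<open>magic_positive_imp_coeff_inequality\<close>. For \<open>n = 3\<close> and \<open>m = 5, 6\<close> an expansion with nonnegative
coefficients is written down.\<close>

section \<open>Inequalities for the partial permutohedron\<close>

lemma finite_bounded_entry_vectors:
  assumes "finite A"
  shows "finite {x :: 'a ^ 'm. \<forall>i. x $ i \<in> A}"
proof (rule finite_subset)
  show "{x :: 'a ^ 'm. \<forall>i. x $ i \<in> A} \<subseteq> vec_lambda ` (UNIV \<rightarrow>\<^sub>E A)"
  proof
    fix x :: "'a ^ 'm" assume "x \<in> {x. \<forall>i. x $ i \<in> A}"
    then have "vec_nth x \<in> UNIV \<rightarrow>\<^sub>E A" by auto
    then show "x \<in> vec_lambda ` (UNIV \<rightarrow>\<^sub>E A)"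
      by (metis image_eqI vec_nth_inverse)
  qed
  show "finite (vec_lambda ` ((UNIV :: 'm set) \<rightarrow>\<^sub>E A) :: ('a ^ 'm) set)"
    using assms by (intro finite_imageI finite_PiE) auto
qed

definition partial_permutation_vectors :: "nat \<Rightarrow> (real ^ 'm) set" where
  "partial_permutation_vectors n = {x. (\<forall>i. x $ i \<in> real ` {0..n}) \<and>
     (\<forall>i j. i \<noteq> j \<and> x $ i \<noteq> 0 \<and> x $ j \<noteq> 0 \<longrightarrow> x $ i \<noteq> x $ j)}"

text \<open>With truncated subtraction the three right-hand sides are the largest possible sums of one, two
and three or more entries: \<open>1, 1, 1\<close> for \<open>n = 1\<close>, \<open>2, 3, 3\<close> for \<open>n = 2\<close> and \<open>3, 5, 6\<close>
for \<open>n = 3\<close>. This lets one argument cover all three polytopes.\<close>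
definition permutohedron_system :: "nat \<Rightarrow> (real ^ 'm) set" where
  "permutohedron_system n = {x. (\<forall>i. 0 \<le> x $ i \<and> x $ i \<le> real n) \<and>
     (\<forall>i j. i \<noteq> j \<longrightarrow> x $ i + x $ j \<le> real (n + (n - 1))) \<and>
     (\<Sum>i\<in>UNIV. x $ i) \<le> real (n + (n - 1) + (n - 2))}"

lemma compact_partial_permutohedron: "compact (partial_permutohedron n :: (real ^ 'm) set)"
proof -
  have "finite (partial_permutation_vectors n :: (real ^ 'm) set)"
    unfolding partial_permutation_vectors_def
    by (rule finite_subset[OF _ finite_bounded_entry_vectors[of "real ` {0..n}"]]) auto
  then show ?thesis
    unfolding partial_permutohedron_def partial_permutation_vectors_def[symmetric]
    by (intro compact_convex_hull finite_imp_compact)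
qed

lemma convex_permutohedron_system: "convex (permutohedron_system n)"
proof -
  have eq: "permutohedron_system n =
     (\<Inter>i. {x. axis i 1 \<bullet> x \<ge> 0} \<inter> {x. axis i 1 \<bullet> x \<le> real n}) \<inter>
     (\<Inter>(i, j)\<in>{(i, j). i \<noteq> j}. {x. (axis i 1 + axis j 1) \<bullet> x \<le> real (n + (n - 1))}) \<inter>
     {x. (\<Sum>i\<in>UNIV. axis i 1) \<bullet> x \<le> real (n + (n - 1) + (n - 2))}"
    by (auto simp: permutohedron_system_def inner_axis' inner_add_left inner_sum_left)
  show ?thesis
    unfolding eq
    by (intro convex_Int convex_INT ballI) (auto simp: convex_halfspace_le convex_halfspace_ge)
qed

text \<open>The nonzero entries are distinct members of \<open>{1..n}\<close>, so their total is at most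
\<open>1 + \<dots> + n\<close>; for \<open>n \<le> 3\<close> this equals \<open>n + (n - 1) + (n - 2)\<close>.\<close>
lemma partial_permutation_vectors_subset_system:
  assumes "n \<le> 3"
  shows "partial_permutation_vectors n \<subseteq> (permutohedron_system n :: (real ^ 'm) set)"
proof
  fix x :: "real ^ 'm" assume x: "x \<in> partial_permutation_vectors n"
  define g where "g i = nat \<lfloor>x $ i\<rfloor>" for i
  have xg: "x $ i = real (g i)" and g_le: "g i \<le> n" for i
    using x by (auto simp: partial_permutation_vectors_def g_def dest!: spec[of _ i])
  have g_inj: "g i \<noteq> g j" if "i \<noteq> j" "g i \<noteq> 0" "g j \<noteq> 0" for i j
    using x that by (auto simp: partial_permutation_vectors_def xg)
  have "sum g UNIV = sum g {i. g i \<noteq> 0}"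
    by (rule sum.mono_neutral_right) auto
  also have "\<dots> = \<Sum>(g ` {i. g i \<noteq> 0})"
    by (subst sum.reindex) (use g_inj in \<open>auto intro!: inj_onI\<close>)
  also have "\<dots> \<le> \<Sum>{0..n}"
    by (rule sum_mono2) (auto simp: g_le)
  also have "\<dots> = n + (n - 1) + (n - 2)"
  proof -
    have "n = 0 \<or> n = 1 \<or> n = 2 \<or> n = 3" using assms by auto
    then show ?thesis by (auto simp: numeral_eq_Suc)
  qed
  finally have total: "sum g UNIV \<le> n + (n - 1) + (n - 2)" .
  have pair: "g i + g j \<le> n + (n - 1)" if "i \<noteq> j" for i j
    using g_inj[OF that] g_le[of i] g_le[of j] by (cases "g i = 0"; cases "g j = 0") auto
  have "real (sum g UNIV) \<le> real (n + (n - 1) + (n - 2))"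
    using total by (simp only: of_nat_le_iff)
  moreover have "real (g i + g j) \<le> real (n + (n - 1))" if "i \<noteq> j" for i j
    using pair[OF that] by (simp only: of_nat_le_iff)
  ultimately show "x \<in> permutohedron_system n"
    by (auto simp: permutohedron_system_def xg g_le)
qed

lemma obtain_three_largest:
  fixes c :: "'m::finite \<Rightarrow> real"
  assumes "CARD('m) \<ge> 3"
  obtains i j k where "distinct [i, j, k]" "c j \<le> c i" "c k \<le> c j"
    "\<And>l. l \<notin> {i, j, k} \<Longrightarrow> c l \<le> c k"
proof -
  have max_ex: "\<exists>i. i \<notin> A \<and> (\<forall>l. l \<notin> A \<longrightarrow> c l \<le> c i)" if "card A < CARD('m)" for A :: "'m set"
  proof -
    have ne: "- A \<noteq> {}" using that by (metis Compl_UNIV_eq double_complement nat_neq_iff)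
    then have "Max (c ` (- A)) \<in> c ` (- A)" by (intro Max_in) auto
    then obtain i where "i \<in> - A" "c i = Max (c ` (- A))" by auto
    then show ?thesis by (intro exI[of _ i]) auto
  qed
  obtain i where i: "\<And>l. c l \<le> c i" using max_ex[of "{}"] assms by auto
  obtain j where j: "j \<noteq> i" "\<And>l. l \<noteq> i \<Longrightarrow> c l \<le> c j"
    using max_ex[of "{i}"] assms by auto
  have "card {i, j} < CARD('m)" using j(1) assms by simp
  then obtain k where k: "k \<notin> {i, j}" "\<And>l. l \<notin> {i, j} \<Longrightarrow> c l \<le> c k"
    using max_ex[of "{i, j}"] by blast
  show ?thesis by (rule that[of i j k]) (use i j k in auto)
qed

text \<open>This is the greedy algorithm for a polymatroid. To maximise \<open>c\<close> over the system, give
\<open>n\<close>, \<open>n - 1\<close>, \<open>n - 2\<close> to the three largest coefficients, skipping nonpositive ones.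
Abel summation bounds \<open>c \<bullet> x\<close> by a nonnegative combination of one entry, one pair of entries and
the total, which are exactly the quantities that the system controls.\<close>
lemma partial_permutation_vector_maximises:
  fixes c x :: "real ^ 'm"
  assumes m: "CARD('m) \<ge> 3" and n: "n \<le> 3" and x: "x \<in> permutohedron_system n"
  obtains v where "v \<in> partial_permutation_vectors n" "c \<bullet> x \<le> c \<bullet> v"
proof -
  define p where "p l = max (c $ l) 0" for l
  obtain i j k where ijk: "distinct [i, j, k]" and ij: "p j \<le> p i" and jk: "p k \<le> p j"
    and rest: "\<And>l. l \<notin> {i, j, k} \<Longrightarrow> p l \<le> p k"
    using obtain_three_largest[OF m, of p] by blast
  define w where "w = (\<lambda>l. if l = i then n else if l = j then n - 1 else if l = k then n - 2 else 0)"
  define v :: "real ^ 'm" where "v = (\<chi> l. if c $ l > 0 then real (w l) else 0)"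
  have split: "sum h UNIV = h i + h j + h k + sum h (- {i, j, k})" for h :: "'m \<Rightarrow> real"
    using sum.subset_diff[of "{i, j, k}" UNIV h] ijk by (simp add: Compl_eq_Diff_UNIV)
  have x0: "0 \<le> x $ l" for l using x by (simp add: permutohedron_system_def)
  have "c \<bullet> x \<le> (\<Sum>l\<in>UNIV. p l * x $ l)"
    unfolding inner_vec_def
    by (rule sum_mono) (auto simp: p_def intro!: mult_right_mono x0)
  also have "\<dots> = p i * x $ i + p j * x $ j + p k * x $ k + (\<Sum>l\<in>-{i, j, k}. p l * x $ l)"
    by (rule split)
  also have "\<dots> \<le> p i * x $ i + p j * x $ j + p k * x $ k + (\<Sum>l\<in>-{i, j, k}. p k * x $ l)"
    by (intro add_left_mono sum_mono mult_right_mono x0 rest) auto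
  also have "\<dots> = (p i - p j) * x $ i + (p j - p k) * (x $ i + x $ j) + p k * (\<Sum>l\<in>UNIV. x $ l)"
    by (simp add: split[of "vec_nth x"] sum_distrib_left[symmetric] algebra_simps)
  also have "\<dots> \<le> (p i - p j) * real n + (p j - p k) * real (n + (n - 1))
                    + p k * real (n + (n - 1) + (n - 2))"
    using x ij jk ijk by (intro add_mono mult_left_mono)
      (auto simp: permutohedron_system_def p_def)
  also have "\<dots> = p i * real n + p j * real (n - 1) + p k * real (n - 2)"
    by (simp add: algebra_simps)
  also have "\<dots> = (\<Sum>l\<in>UNIV. p l * real (w l))"
    using ijk by (subst split) (auto simp: w_def intro!: sum.neutral)
  also have "\<dots> = c \<bullet> v"
    unfolding inner_vec_def by (rule sum.cong) (auto simp: p_def v_def)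
  finally have "c \<bullet> x \<le> c \<bullet> v" .
  moreover have "v \<in> partial_permutation_vectors n"
    by (auto simp: partial_permutation_vectors_def v_def w_def)
  ultimately show ?thesis by (rule that[rotated])
qed

text \<open>A point of the system outside the hull would be separated from it by a linear functional, but
every linear functional attains its maximum over the system at a generating vector.\<close>
theorem partial_permutohedron_eq_system:
  assumes m: "CARD('m) \<ge> 3" and n: "n \<le> 3"
  shows "(partial_permutohedron n :: (real ^ 'm) set) = permutohedron_system n"
proof
  have hull: "(partial_permutohedron n :: (real ^ 'm) set) =
      convex hull partial_permutation_vectors n"
    by (simp add: partial_permutohedron_def partial_permutation_vectors_def)
  show "partial_permutohedron n \<subseteq> (permutohedron_system n :: (real ^ 'm) set)"
    unfolding hull
    using partial_permutation_vectors_subset_system[OF n] convex_permutohedron_system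
    by (rule hull_minimal)
  show "(permutohedron_system n :: (real ^ 'm) set) \<subseteq> partial_permutohedron n"
  proof (rule ccontr)
    assume "\<not> ?thesis"
    then obtain x :: "real ^ 'm" where x: "x \<in> permutohedron_system n"
      and "x \<notin> partial_permutohedron n" by blast
    moreover have "convex (partial_permutohedron n :: (real ^ 'm) set)"
      by (simp add: partial_permutohedron_def)
    moreover have "closed (partial_permutohedron n :: (real ^ 'm) set)"
      by (intro compact_imp_closed compact_partial_permutohedron)
    ultimately obtain a b where a: "a \<bullet> x < b" "\<forall>y\<in>partial_permutohedron n. a \<bullet> y > b"
      using separating_hyperplane_closed_point by blast
    obtain v where v: "v \<in> partial_permutation_vectors n" "(- a) \<bullet> x \<le> (- a) \<bullet> v"
      using partial_permutation_vector_maximises[OF m n x] by blast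
    have "v \<in> partial_permutohedron n" unfolding hull using v(1) by (rule hull_inc)
    with a v(2) show False by force
  qed
qed

lemma aff_dim_partial_permutohedron:
  assumes "n \<ge> 1"
  shows "aff_dim (partial_permutohedron n :: (real ^ 'm) set) = int CARD('m)"
proof -
  let ?P = "partial_permutohedron n :: (real ^ 'm) set"
  have zero: "0 \<in> ?P"
    unfolding partial_permutohedron_def by (rule hull_inc) auto
  have "b \<in> ?P" if b: "b \<in> Basis" for b
  proof -
    obtain i where "b = axis i 1" using b by (auto simp: Basis_vec_def)
    then show ?thesis
      unfolding partial_permutohedron_def using assms
      by (intro hull_inc) (auto simp: axis_def image_iff intro: bexI[of _ 0] bexI[of _ 1])
  qed
  then have "span Basis \<subseteq> span ?P" by (intro span_mono) auto
  then have "affine hull ?P = UNIV"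
    using affine_hull_span_0[OF hull_inc[OF zero]] by auto
  then show ?thesis by (simp add: aff_dim_eq_full[symmetric])
qed

section \<open>Counting integer points by the violated constraint\<close>

definition natural_simplex :: "'a set \<Rightarrow> nat \<Rightarrow> ('a \<Rightarrow> nat) set" where
  "natural_simplex I N = {g. (\<forall>i. i \<notin> I \<longrightarrow> g i = 0) \<and> sum g I \<le> N}"

text \<open>Recursion on the last coordinate reduces the count to the hockey-stick identity for binomial
coefficients.\<close>
lemma card_natural_simplex:
  assumes "finite I"
  shows "finite (natural_simplex I N) \<and> card (natural_simplex I N) = (N + card I) choose card I"
  using assms
proof (induction I arbitrary: N rule: finite_induct)
  case empty
  have "natural_simplex ({} :: 'a set) N = {\<lambda>_. 0}" by (auto simp: natural_simplex_def)
  then show ?case by simp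
next
  case (insert a I)
  let ?S = "SIGMA s:{..N}. natural_simplex I s"
  let ?f = "\<lambda>(s, g). g(a := N - s)"
  have sum_upd: "sum (g(a := s)) I = sum g I" for g s
    using insert by (intro sum.cong) auto
  have inj: "inj_on ?f ?S"
  proof (rule inj_onI, clarify)
    fix s g s' g'
    assume *: "s \<le> N" "s' \<le> N" "g \<in> natural_simplex I s" "g' \<in> natural_simplex I s'"
      "g(a := N - s) = g'(a := N - s')"
    have "s = s'" using fun_cong[OF *(5), of a] *(1,2) by simp
    moreover have "g i = g' i" for i
      using fun_cong[OF *(5), of i] *(3,4) insert(2)
      by (cases "i = a") (auto simp: natural_simplex_def)
    ultimately show "s = s' \<and> g = g'" by auto
  qed
  have img: "natural_simplex (insert a I) N = ?f ` ?S"
  proof (intro equalityI subsetI)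
    fix g assume "g \<in> natural_simplex (insert a I) N"
    then have g: "\<And>i. i \<notin> insert a I \<Longrightarrow> g i = 0" "g a + sum g I \<le> N"
      using insert by (auto simp: natural_simplex_def)
    have "sum (g(a := 0)) I \<le> N - g a"
      using g(2) unfolding sum_upd by simp
    then have "(N - g a, g(a := 0)) \<in> ?S"
      using g(1) by (auto simp: natural_simplex_def)
    moreover have "g = ?f (N - g a, g(a := 0))" using g(2) by auto
    ultimately show "g \<in> ?f ` ?S" by (rule rev_image_eqI)
  next
    fix g assume "g \<in> ?f ` ?S"
    then obtain s h where "s \<le> N" "h \<in> natural_simplex I s" "g = h(a := N - s)" by auto
    moreover from this have "sum g I = sum h I" by (simp only: sum_upd)
    ultimately show "g \<in> natural_simplex (insert a I) N"
      using insert by (auto simp: natural_simplex_def)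
  qed
  have "card (natural_simplex (insert a I) N) = (\<Sum>s\<le>N. (s + card I) choose card I)"
    unfolding img using inj insert.IH by (simp add: card_image)
  also have "\<dots> = (\<Sum>s\<le>N. (card I + s) choose s)"
    by (intro sum.cong refl) (metis add.commute binomial_symmetric diff_add_inverse le_add1)
  also have "\<dots> = Suc (card I + N) choose N" by (rule sum_choose_lower)
  also have "\<dots> = (N + card (insert a I)) choose card (insert a I)"
    using insert by (subst binomial_symmetric) (auto simp: add.commute)
  finally show ?case unfolding img using insert.IH by simp
qed

lemma finite_natural_simplex: "finite I \<Longrightarrow> finite (natural_simplex I N)"
  using card_natural_simplex by blast

text \<open>The parameters \<open>a\<close>, \<open>b\<close>, \<open>c\<close> are the bounds on one entry, on a pair of entries and on the
total. Lattice points that satisfy the bound on the total but not the others are sorted by the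
violated constraint; a pair counts as a violator only when all single entries obey their bound.\<close>
context
  fixes a b c :: nat
begin

definition feasible :: "('m::finite \<Rightarrow> nat) set" where
  "feasible = {g. (\<forall>i. g i \<le> a) \<and> (\<forall>i j. i \<noteq> j \<longrightarrow> g i + g j \<le> b) \<and> sum g UNIV \<le> c}"

definition entry_violators :: "'m \<Rightarrow> ('m::finite \<Rightarrow> nat) set" where
  "entry_violators i = {g. g i > a \<and> sum g UNIV \<le> c}"

definition pair_violators :: "'m set \<Rightarrow> ('m::finite \<Rightarrow> nat) set" where
  "pair_violators e = {g. (\<forall>i. g i \<le> a) \<and> sum g e > b \<and> sum g UNIV \<le> c}"

text \<open>Lowering the offending entry by \<open>a + 1\<close> yields an arbitrary point of a smaller simplex. For
\<open>a = c\<close> there is no violator and the binomial coefficient vanishes as well.\<close>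
lemma card_entry_violators:
  assumes "a \<le> c"
  shows "card (entry_violators (i :: 'm::finite)) = (c - a + CARD('m) - 1) choose CARD('m)"
proof (cases "a = c")
  case True
  have False if "g i > a" "sum g UNIV \<le> c" for g :: "'m \<Rightarrow> nat"
    using member_le_sum[of i UNIV g] that True by simp
  then have "entry_violators i = ({} :: ('m \<Rightarrow> nat) set)"
    by (auto simp: entry_violators_def)
  moreover have "(c - a + CARD('m) - 1) choose CARD('m) = 0"
    using True by (intro binomial_eq_0) simp
  ultimately show ?thesis by (simp only: card.empty)
next
  case False
  let ?S = "natural_simplex (UNIV :: 'm set) (c - a - 1)"
  let ?f = "\<lambda>g :: 'm \<Rightarrow> nat. g(i := g i + a + 1)"
  have split: "sum g UNIV = g i + sum g (- {i})" for g :: "'m \<Rightarrow> nat"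
    unfolding Compl_eq_Diff_UNIV by (rule sum.remove) auto
  have upd: "sum (g(i := k)) UNIV = k + sum g (- {i})" for g :: "'m \<Rightarrow> nat" and k
    by (subst split) (auto intro!: sum.cong)
  have "entry_violators i = ?f ` ?S"
  proof (intro equalityI subsetI)
    fix g assume "g \<in> (entry_violators i :: ('m \<Rightarrow> nat) set)"
    then have g: "g i > a" "g i + sum g (- {i}) \<le> c"
      by (auto simp: entry_violators_def split)
    then have "sum (g(i := g i - a - 1)) UNIV \<le> c - a - 1" unfolding upd by simp
    then have "g(i := g i - a - 1) \<in> ?S" by (simp add: natural_simplex_def)
    moreover have "g = ?f (g(i := g i - a - 1))" using g by auto
    ultimately show "g \<in> ?f ` ?S" by (intro image_eqI[of g ?f "g(i := g i - a - 1)"])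
  next
    fix g assume "g \<in> ?f ` ?S"
    then obtain h where g: "g = ?f h" and "sum h UNIV \<le> c - a - 1"
      by (auto simp: natural_simplex_def)
    then have "sum g UNIV \<le> c" using False assms unfolding g upd split[of h] by simp
    then show "g \<in> entry_violators i" by (simp add: entry_violators_def g)
  qed
  moreover have "inj_on ?f ?S"
  proof (rule inj_onI)
    fix g h assume eq: "?f g = ?f h"
    show "g = h"
    proof
      fix l show "g l = h l" using fun_cong[OF eq, of l] by (cases "l = i") auto
    qed
  qed
  ultimately show ?thesis
    using False assms by (simp add: card_image card_natural_simplex)
qed

text \<open>The hypotheses say that a point with bounded total violates at most one constraint. Two entries
above \<open>a\<close> would have sum at least \<open>2 * a + 2\<close>. Two different pairs above \<open>b\<close> share at most one
index, whose entry is at most \<open>a\<close>, which would force \<open>2 * b + 2 \<le> a + c\<close>. Hence no inclusion-exclusion is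
needed: the simplex is a disjoint union.\<close>
lemma card_natural_simplex_decomposition:
  assumes "c \<le> 2 * a + 1" "a + c \<le> 2 * b + 1" "a \<le> c"
  shows "(c + CARD('m)) choose CARD('m) =
     card (feasible :: ('m::finite \<Rightarrow> nat) set)
     + CARD('m) * ((c - a + CARD('m) - 1) choose CARD('m))
     + (\<Sum>e | card e = 2. card (pair_violators e :: ('m \<Rightarrow> nat) set))"
proof -
  let ?T = "natural_simplex (UNIV :: 'm set) c"
  let ?A = "\<Union>i. entry_violators (i :: 'm)"
  let ?B = "\<Union>e\<in>{e. card e = 2}. pair_violators (e :: 'm set)"
  have finT: "finite ?T" by (rule finite_natural_simplex) simp
  have finA: "finite (entry_violators (i :: 'm))" for i
    by (rule finite_subset[OF _ finT]) (auto simp: entry_violators_def natural_simplex_def)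
  have finB: "finite (pair_violators (e :: 'm set))" for e
    by (rule finite_subset[OF _ finT]) (auto simp: pair_violators_def natural_simplex_def)
  have finF: "finite (feasible :: ('m \<Rightarrow> nat) set)"
    by (rule finite_subset[OF _ finT]) (auto simp: feasible_def natural_simplex_def)
  have sub: "sum g e \<le> sum g UNIV" for e and g :: "'m \<Rightarrow> nat"
    by (rule sum_mono2) auto
  have disjA: "entry_violators i \<inter> entry_violators j = {}" if "i \<noteq> j" for i j :: 'm
  proof -
    have "g i + g j \<le> sum g UNIV" for g :: "'m \<Rightarrow> nat" using sub[of g "{i, j}"] that by simp
    note pair_le = this
    have False if "g i > a" "g j > a" "sum g UNIV \<le> c" for g :: "'m \<Rightarrow> nat"
      using that pair_le[of g] assms(1) by simp
    then show ?thesis by (auto simp: entry_violators_def)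
  qed
  have disjB: "pair_violators e \<inter> pair_violators e' = {}"
    if "card e = 2" "card e' = 2" "e \<noteq> e'" for e e' :: "'m set"
  proof (rule ccontr)
    assume "pair_violators e \<inter> pair_violators e' \<noteq> {}"
    then obtain g where g: "\<And>i. g i \<le> a" "sum g e > b" "sum g e' > b" "sum g UNIV \<le> c"
      by (auto simp: pair_violators_def)
    have "card (e \<inter> e') < 2"
    proof (rule ccontr)
      assume "\<not> card (e \<inter> e') < 2"
      then have "e \<inter> e' = e" "e \<inter> e' = e'"
        using that card_seteq[of e "e \<inter> e'"] card_seteq[of e' "e \<inter> e'"] by auto
      with that show False by simp
    qed
    then have "card (e \<inter> e') * a \<le> 1 * a" by (intro mult_right_mono) auto
    moreover have "sum g (e \<inter> e') \<le> card (e \<inter> e') * a"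
      using sum_bounded_above[of "e \<inter> e'" g a] g(1) by simp
    ultimately have "sum g (e \<inter> e') \<le> a" by linarith
    moreover have "sum g e + sum g e' = sum g (e \<union> e') + sum g (e \<inter> e')"
      by (simp add: sum.union_inter)
    moreover have "sum g (e \<union> e') \<le> c" using sub g(4) le_trans by blast
    ultimately show False using g assms(2) by simp
  qed
  have "?T = feasible \<union> ?A \<union> ?B"
  proof (intro equalityI subsetI)
    fix g assume g: "g \<in> ?T"
    show "g \<in> feasible \<union> ?A \<union> ?B"
    proof (rule ccontr)
      assume neg: "g \<notin> feasible \<union> ?A \<union> ?B"
      have le: "g i \<le> a" for i
        using neg g by (auto simp: entry_violators_def natural_simplex_def not_less)
      obtain i j where "i \<noteq> j" "g i + g j > b"
        using neg g le by (auto simp: feasible_def natural_simplex_def not_le)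
      then have "card {i, j} = 2" "g \<in> pair_violators {i, j}"
        using g le by (auto simp: pair_violators_def natural_simplex_def)
      with neg show False by blast
    qed
  qed (auto simp: feasible_def entry_violators_def pair_violators_def natural_simplex_def)
  moreover have "feasible \<inter> ?A = {}"
    by (auto simp: feasible_def entry_violators_def not_less[symmetric])
  moreover have "g \<notin> pair_violators e" if "g \<in> feasible \<union> ?A" "card e = 2" for g and e :: "'m set"
    using that by (auto simp: feasible_def entry_violators_def pair_violators_def card_2_iff
        not_less[symmetric])
  then have "(feasible \<union> ?A) \<inter> ?B = {}" by blast
  ultimately have "card ?T = card (feasible :: ('m \<Rightarrow> nat) set) + card ?A + card ?B"
    using finA finB finF by (simp add: card_Un_disjoint)
  also have "card ?A = (\<Sum>i\<in>(UNIV :: 'm set). card (entry_violators i))"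
    using finA disjA by (intro card_UN_disjoint) auto
  also have "\<dots> = CARD('m) * ((c - a + CARD('m) - 1) choose CARD('m))"
    by (simp add: card_entry_violators[OF assms(3)])
  also have "card ?B = (\<Sum>e | card e = 2. card (pair_violators e :: ('m \<Rightarrow> nat) set))"
    using finB disjB by (intro card_UN_disjoint) auto
  finally show ?thesis by (simp add: card_natural_simplex)
qed

lemma pair_violators_empty:
  assumes "c \<le> b"
  shows "pair_violators (e :: 'm::finite set) = {}"
proof -
  have "sum g e \<le> sum g UNIV" for g :: "'m \<Rightarrow> nat" by (rule sum_mono2) auto
  then have "\<not> (sum g e > b \<and> sum g UNIV \<le> c)" for g :: "'m \<Rightarrow> nat"
    using assms by (meson leD le_trans)
  then show ?thesis by (auto simp: pair_violators_def)
qed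

text \<open>When the total may be \<open>2 * a\<close>, the defects \<open>a - g i\<close> of the two entries of the pair have a sum
\<open>u < t\<close>, which also bounds the sum of the remaining entries. There are \<open>u + 1\<close> ways to split
\<open>u\<close> into two defects.\<close>
lemma card_pair_violators:
  assumes e: "card (e :: 'm::finite set) = 2" and c: "c = 2 * a" and t: "b + t = c" "t \<le> a"
  shows "card (pair_violators e) =
    (\<Sum>u<t. (u + 1) * ((u + (CARD('m) - 2)) choose (CARD('m) - 2)))"
proof -
  \<comment> \<open>The triple \<open>(u, v, h)\<close> records the total defect, the defect of \<open>i\<close>, and the other entries.\<close>
  obtain i j where ij: "e = {i, j}" "i \<noteq> j" using e by (auto simp: card_2_iff)
  let ?S = "SIGMA u:{..<t}. {..u} \<times> natural_simplex (- e) u"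
  let ?f = "\<lambda>(u, v, h). h(i := a - v, j := a - (u - v))"
  have split: "sum g UNIV = sum g e + sum g (- e)" for g :: "'m \<Rightarrow> nat"
    using sum.subset_diff[of e UNIV g] by (simp add: Compl_eq_Diff_UNIV)
  have same: "sum (h(i := p, j := q)) (- e) = sum h (- e)" for h p q
    by (intro sum.cong) (auto simp: ij)
  have pair: "sum g e = g i + g j" for g using ij by simp
  have "pair_violators e = ?f ` ?S"
  proof (intro equalityI subsetI)
    fix g assume "g \<in> (pair_violators e)"
    then have g: "\<And>i. g i \<le> a" "g i + g j > b" "g i + g j + sum g (- e) \<le> c"
      by (auto simp: pair_violators_def split[of g] pair)
    let ?x = "(2 * a - (g i + g j), a - g i, g(i := 0, j := 0))"
    have "sum g (- e) \<le> 2 * a - (g i + g j)" using g(3) c by simp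
    then have "?x \<in> ?S"
      using g(2) g(1)[of i] g(1)[of j] c t
      by (auto simp: natural_simplex_def same) (auto simp: ij)
    moreover have "g = ?f ?x"
    proof (rule ext)
      fix l show "g l = ?f ?x l" using g(1)[of i] g(1)[of j] by auto
    qed
    ultimately show "g \<in> ?f ` ?S" by (rule rev_image_eqI)
  next
    fix g assume "g \<in> ?f ` ?S"
    then obtain u v h where g: "g = h(i := a - v, j := a - (u - v))"
      and u: "u < t" "v \<le> u" and h: "\<And>l. l \<in> e \<Longrightarrow> h l = 0" "sum h (- e) \<le> u"
      by (auto simp: natural_simplex_def)
    have gs: "sum g (- e) = sum h (- e)" unfolding g by (rule same)
    have ge: "g i = a - v" "g j = a - (u - v)" using ij by (auto simp: g)
    have "h l \<le> u" for l
      using h member_le_sum[of l "- e" h] by (cases "l \<in> e") auto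
    then have "g l \<le> a" for l using u t by (auto simp: g intro: order_trans[of _ u])
    moreover have "sum g e > b" "sum g UNIV \<le> c"
      using u t c h(2) ij(2) by (simp_all add: split[of g] pair ge gs)
    ultimately show "g \<in> pair_violators e" by (simp add: pair_violators_def)
  qed
  moreover have "inj_on ?f ?S"
  proof (rule inj_onI)
    fix x y assume xS: "x \<in> ?S" and yS: "y \<in> ?S" and eq: "?f x = ?f y"
    obtain u v h where x: "x = (u, v, h)" by (cases x)
    obtain u' v' h' where y: "y = (u', v', h')" by (cases y)
    have app: "(h(i := a - v, j := a - (u - v))) l = (h'(i := a - v', j := a - (u' - v'))) l" for l
      using eq by (simp only: x y prod.case)
    have "v = v'" "u = u'"
      using app[of i] app[of j] xS yS ij t by (auto simp: x y)
    moreover have "h l = h' l" for l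
      using app[of l] xS yS by (cases "l \<in> e") (auto simp: ij natural_simplex_def x y)
    ultimately show "x = y" by (auto simp: x y)
  qed
  moreover have "card (- e) = CARD('m) - 2"
    unfolding Compl_eq_Diff_UNIV using e by (subst card_Diff_subset) auto
  ultimately show ?thesis
    by (simp add: card_image card_natural_simplex card_SigmaI card_cartesian_product)
qed

end

text \<open>Written through \<open>pochhammer\<close>, the number of pair violators is visibly a polynomial in \<open>t\<close>.\<close>
lemma sum_pair_violators_binomial:
  "real (\<Sum>u<t. (u + 1) * ((u + k) choose k)) =
     pochhammer (real t) (k + 1) * (real (k + 1) * real t + 1) / fact (k + 2)"
proof (induction t)
  case 0
  then show ?case by (simp add: pochhammer_0_left)
next
  case (Suc t)
  let ?Q = "pochhammer (real t + 1) k"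
  have "real ((t + k) choose k) = ?Q / fact k"
    by (simp add: binomial_gbinomial gbinomial_pochhammer')
  then have "real (\<Sum>u<Suc t. (u + 1) * ((u + k) choose k)) =
     real (\<Sum>u<t. (u + 1) * ((u + k) choose k)) + (real t + 1) * (?Q / fact k)"
    by (simp add: distrib_right add_divide_distrib)
  also note Suc
  also have "pochhammer (real t) (k + 1) = real t * ?Q"
    by (simp add: pochhammer_rec)
  also have "?Q / fact k = ?Q * ((real k + 1) * (real k + 2)) / fact (k + 2)"
  proof -
    have "fact (k + 2) = (fact k * ((real k + 1) * (real k + 2)) :: real)"
      by (simp add: algebra_simps)
    moreover have "(real k + 1) * (real k + 2) \<noteq> 0"
      by (simp add: add_nonneg_eq_0_iff)
    ultimately show ?thesis by (metis mult_divide_mult_cancel_right)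
  qed
  also have "real t * ?Q * (real (k + 1) * real t + 1) / fact (k + 2)
       + (real t + 1) * (?Q * ((real k + 1) * (real k + 2)) / fact (k + 2))
     = ?Q * (real t * (real (k + 1) * real t + 1) + (real t + 1) * (real k + 1) * (real k + 2)) / fact (k + 2)"
    by (simp only: add_divide_distrib[symmetric] times_divide_eq_right) (simp only: distrib_left distrib_right mult_ac add_ac)
  also have "real t * (real (k + 1) * real t + 1) + (real t + 1) * (real k + 1) * (real k + 2)
     = (real t + 1 + real k) * (real (k + 1) * real (Suc t) + 1)"
    by (simp add: algebra_simps)
  also have "?Q * ((real t + 1 + real k) * (real (k + 1) * real (Suc t) + 1)) / fact (k + 2)
     = pochhammer (real (Suc t)) (k + 1) * (real (k + 1) * real (Suc t) + 1) / fact (k + 2)"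
    by (simp add: pochhammer_rec' algebra_simps)
  finally show ?case .
qed

section \<open>The Ehrhart polynomial\<close>

text \<open>The three summands are the polynomial forms of the sizes of the simplex, of the entry violators
and of the pair violators. The last occur only for \<open>n = 3\<close>: for \<open>n \<le> 2\<close> the bound on a pair
coincides with the bound on the total.\<close>
definition ehrhart_formula :: "nat \<Rightarrow> nat \<Rightarrow> real poly" where
  "ehrhart_formula m n = smult (1 / fact m)
     (pochhammer [:1, real (n + (n - 1) + (n - 2)):] m
      - smult (real m) (pochhammer [:0, real (n - 1 + (n - 2)):] m)
      - (if n = 3 then smult (real (m choose 2)) (pochhammer [:0, 1:] (m - 1) * [:1, real (m - 1):]) else 0))"

lemma poly_pochhammer: "poly (pochhammer p k) x = pochhammer (poly p x) k"
  by (induction k) (simp_all add: pochhammer_rec' poly_mult)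

lemma poly_ehrhart_formula:
  "poly (ehrhart_formula m n) x =
     (pochhammer (1 + real (n + (n - 1) + (n - 2)) * x) m
      - real m * pochhammer (real (n - 1 + (n - 2)) * x) m
      - (if n = 3 then real (m choose 2) * pochhammer x (m - 1) * (1 + real (m - 1) * x) else 0)) / fact m"
  by (simp add: ehrhart_formula_def poly_pochhammer mult_ac) (simp add: algebra_simps)

lemma binomial_eq_pochhammer: "real ((N + m) choose m) = pochhammer (1 + real N) m / fact m"
  by (simp add: binomial_gbinomial gbinomial_pochhammer' algebra_simps)

lemma binomial_diff_1_eq_pochhammer:
  assumes "m \<ge> 1"
  shows "real ((N + m - 1) choose m) = pochhammer (real N) m / fact m"
proof -
  have "real (N + m - 1) - real m + 1 = real N" using assms by simp
  then show ?thesis by (simp add: binomial_gbinomial gbinomial_pochhammer')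
qed

lemma real_card_feasible:
  assumes m: "CARD('m::finite) \<ge> 3" and n: "1 \<le> n" "n \<le> 3" and t: "t > 0"
  shows "real (card (feasible (t * n) (t * (n + (n - 1))) (t * (n + (n - 1) + (n - 2))) :: ('m \<Rightarrow> nat) set))
     = poly (ehrhart_formula CARD('m) n) (real t)"
proof -
  let ?m = "CARD('m)"
  define a b c where abc: "a = t * n" "b = t * (n + (n - 1))" "c = t * (n + (n - 1) + (n - 2))"
  have n': "n = 1 \<or> n = 2 \<or> n = 3" using n by auto
  have bounds: "c \<le> 2 * a + 1" "a + c \<le> 2 * b + 1" "a \<le> c"
    using n' by (auto simp: abc)
  have ca: "c - a = t * (n - 1 + (n - 2))" using n' by (auto simp: abc)
  have "real (\<Sum>e | card e = 2. card (pair_violators a b c e :: ('m \<Rightarrow> nat) set)) =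
    (if n = 3 then real (?m choose 2) * pochhammer (real t) (?m - 1) * (1 + real (?m - 1) * t) else 0) / fact ?m"
  proof (cases "n = 3")
    case True
    have "c = 2 * a" "b + t = c" "t \<le> a" using True by (auto simp: abc)
    then have card_pair: "card (pair_violators a b c e) =
        (\<Sum>u<t. (u + 1) * ((u + (?m - 2)) choose (?m - 2)))" if "card e = 2" for e :: "'m set"
      by (intro card_pair_violators that)
    define k where "k = ?m - 2"
    have k: "?m = k + 2" using m by (simp add: k_def)
    have "(\<Sum>e | card e = 2. card (pair_violators a b c e :: ('m \<Rightarrow> nat) set)) =
       card {e :: 'm set. card e = 2} * (\<Sum>u<t. (u + 1) * ((u + k) choose k))"
      using card_pair by (simp del: add_mult_distrib add: k)
    also have "card {e :: 'm set. card e = 2} = ?m choose 2"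
      using n_subsets[of "UNIV :: 'm set" 2] by simp
    finally show ?thesis
      using True sum_pair_violators_binomial[where t = t and k = k]
      by (simp only: of_nat_mult) (simp add: k algebra_simps)
  next
    case False
    then have "c \<le> b" using n' by (auto simp: abc)
    then show ?thesis using False by (simp add: pair_violators_empty)
  qed
  moreover have "real (card (feasible a b c :: ('m \<Rightarrow> nat) set)) =
      real ((c + ?m) choose ?m) - real ?m * real ((c - a + ?m - 1) choose ?m)
      - real (\<Sum>e | card e = 2. card (pair_violators a b c e :: ('m \<Rightarrow> nat) set))"
    by (subst card_natural_simplex_decomposition[OF bounds]) simp
  moreover have "real ((c - a + ?m - 1) choose ?m) = pochhammer (real (c - a)) ?m / fact ?m"
    using m by (intro binomial_diff_1_eq_pochhammer) simp
  moreover have "real c = real (n + (n - 1) + (n - 2)) * real t"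
    by (simp only: abc of_nat_mult mult.commute)
  moreover have "real (c - a) = real (n - 1 + (n - 2)) * real t"
    by (simp only: ca of_nat_mult mult.commute)
  ultimately have "real (card (feasible a b c :: ('m \<Rightarrow> nat) set)) = poly (ehrhart_formula ?m n) (real t)"
    by (simp only: poly_ehrhart_formula binomial_eq_pochhammer diff_divide_distrib times_divide_eq_right)
  then show ?thesis by (simp only: abc)
qed

lemma scaled_permutohedron_system:
  assumes t: "(t::nat) > 0"
  shows "(\<lambda>x. real t *\<^sub>R x) ` (permutohedron_system n :: (real ^ 'm) set) \<inter> lattice_points =
     (\<lambda>g. \<chi> i. real (g i)) `
       feasible (t * n) (t * (n + (n - 1))) (t * (n + (n - 1) + (n - 2)))"
    (is "?L = ?f ` ?G")
proof (intro equalityI subsetI)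
  have scale: "real t * r \<le> real t * s \<longleftrightarrow> r \<le> s" for r s using t by simp
  fix y :: "real ^ 'm" assume y: "y \<in> ?L"
  then obtain x where x: "x \<in> permutohedron_system n" and yx: "y = real t *\<^sub>R x" by auto
  define g where "g i = nat \<lfloor>y $ i\<rfloor>" for i
  have "y $ i \<in> \<int>" "0 \<le> y $ i" for i
    using y x by (auto simp: lattice_points_def permutohedron_system_def yx)
  then have yg: "y $ i = real (g i)" for i
    by (simp add: g_def)
  have xg: "real (g i) = real t * x $ i" for i by (simp add: yg[symmetric] yx)
  have "real (g i) \<le> real (t * n)" for i
    using x by (simp add: xg permutohedron_system_def scale)
  moreover have "real (g i + g j) \<le> real (t * (n + (n - 1)))" if "i \<noteq> j" for i j
    using x that
    by (simp only: of_nat_add of_nat_mult xg distrib_left[symmetric] scale permutohedron_system_def) simp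
  moreover have "real (sum g UNIV) \<le> real (t * (n + (n - 1) + (n - 2)))"
    using x
    by (simp only: of_nat_sum of_nat_mult xg sum_distrib_left[symmetric] scale permutohedron_system_def) simp
  ultimately have "g \<in> ?G" unfolding of_nat_le_iff by (simp add: feasible_def)
  moreover have "y = ?f g" by (simp add: vec_eq_iff yg)
  ultimately show "y \<in> ?f ` ?G" by blast
next
  have scale: "r / real t \<le> s \<longleftrightarrow> r \<le> real t * s" for r s using t by (simp add: field_simps)
  fix y :: "real ^ 'm" assume "y \<in> ?f ` ?G"
  then obtain g where y: "y = ?f g" and g: "g \<in> ?G" by blast
  define x where "x = (1 / real t) *\<^sub>R y"
  have "real (g i) \<le> real (t * n)" for i
    using g unfolding of_nat_le_iff by (simp add: feasible_def)
  moreover have "real (g i + g j) \<le> real (t * (n + (n - 1)))" if "i \<noteq> j" for i j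
    using g that unfolding of_nat_le_iff by (simp add: feasible_def)
  moreover have "real (sum g UNIV) \<le> real (t * (n + (n - 1) + (n - 2)))"
    using g unfolding of_nat_le_iff by (simp add: feasible_def)
  ultimately have "x \<in> permutohedron_system n"
    using t unfolding permutohedron_system_def x_def y
    by (simp add: add_divide_distrib[symmetric] sum_divide_distrib[symmetric] scale)
  moreover have "y = real t *\<^sub>R x" using t by (simp add: x_def)
  moreover have "y \<in> lattice_points" by (simp add: y lattice_points_def)
  ultimately show "y \<in> ?L" by blast
qed

text \<open>Two polynomials that agree at all positive integers are equal, so the definite description
picks the polynomial that counts.\<close>
lemma ehrhart_polynomial_eqI:
  assumes "\<And>t::nat. t > 0 \<Longrightarrow>
     poly p (real t) = real (card ((\<lambda>x. real t *\<^sub>R x) ` P \<inter> lattice_points))"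
  shows "ehrhart_polynomial P = p"
  unfolding ehrhart_polynomial_def
proof (rule the_equality)
  fix q assume q: "\<forall>t::nat. t > 0 \<longrightarrow>
     poly q (real t) = real (card ((\<lambda>x. real t *\<^sub>R x) ` P \<inter> lattice_points))"
  have "real ` {0<..} \<subseteq> {x. poly (p - q) x = 0}"
    using assms q by auto
  moreover have "infinite (real ` {0<..})"
    using finite_imageD[of real "{0<..}"] infinite_Ioi by (auto simp: inj_on_def)
  ultimately have "p - q = 0"
    using poly_roots_finite finite_subset by blast
  then show "q = p" by simp
qed (use assms in blast)

theorem ehrhart_polynomial_partial_permutohedron:
  assumes m: "CARD('m) \<ge> 3" and n: "1 \<le> n" "n \<le> 3"
  shows "ehrhart_polynomial (partial_permutohedron n :: (real ^ 'm) set) = ehrhart_formula CARD('m) n"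
proof (rule ehrhart_polynomial_eqI)
  fix t :: nat assume t: "t > 0"
  have "inj (\<lambda>g :: 'm \<Rightarrow> nat. (\<chi> i. real (g i)) :: real ^ 'm)"
    by (rule injI) (auto simp: vec_eq_iff)
  then show "poly (ehrhart_formula CARD('m) n) (real t) =
     real (card ((\<lambda>x. real t *\<^sub>R x) ` (partial_permutohedron n :: (real ^ 'm) set) \<inter> lattice_points))"
    unfolding partial_permutohedron_eq_system[OF m n(2)] scaled_permutohedron_system[OF t]
      real_card_feasible[OF m n t, symmetric]
    by (subst card_image) (auto intro: inj_on_subset)
qed

section \<open>Necessary conditions for magic positivity\<close>

definition magic_positive :: "nat \<Rightarrow> real poly \<Rightarrow> bool" where
  "magic_positive d p \<longleftrightarrow> (\<exists>a :: nat \<Rightarrow> real. (\<forall>i\<le>d. a i \<ge> 0) \<and>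
     p = (\<Sum>i\<le>d. smult (a i) ([:0, 1:] ^ i * [:1, 1:] ^ (d - i))))"

theorem ehrhart_magic_positive_iff:
  assumes "CARD('m) \<ge> 3" and "1 \<le> n" "n \<le> 3"
  shows "ehrhart_magic_positive (partial_permutohedron n :: (real ^ 'm) set) \<longleftrightarrow>
     magic_positive CARD('m) (ehrhart_formula CARD('m) n)"
  using assms by (simp add: ehrhart_magic_positive_def magic_positive_def Let_def
      aff_dim_partial_permutohedron ehrhart_polynomial_partial_permutohedron)

text \<open>For \<open>x \<le> -1\<close> both \<open>- x\<close> and \<open>- (1 + x)\<close> are nonnegative, so every basis polynomial
\<open>x ^ i * (1 + x) ^ (d - i)\<close> has the sign \<open>(-1) ^ d\<close> or vanishes.\<close>
lemma magic_positive_sign: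
  assumes "magic_positive d p" and "x \<le> -1"
  shows "(-1) ^ d * poly p x \<ge> 0"
proof -
  obtain a where a: "\<And>i. i \<le> d \<Longrightarrow> a i \<ge> 0"
    and p: "p = (\<Sum>i\<le>d. smult (a i) ([:0, 1:] ^ i * [:1, 1:] ^ (d - i)))"
    using assms(1) by (auto simp: magic_positive_def)
  have "(-1) ^ d * poly p x = (\<Sum>i\<le>d. a i * ((-x) ^ i * (- 1 - x) ^ (d - i)))"
    unfolding p poly_sum sum_distrib_left
  proof (rule sum.cong)
    fix i assume "i \<in> {..d}"
    then have "(-1) ^ d = (-1) ^ i * (-1 :: real) ^ (d - i)" by (simp flip: power_add)
    then have "(-1) ^ d * (x ^ i * (1 + x) ^ (d - i)) = ((-1) * x) ^ i * ((-1) * (1 + x)) ^ (d - i)"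
      unfolding power_mult_distrib by (simp only: mult_ac)
    then show "(-1) ^ d * poly (smult (a i) ([:0, 1:] ^ i * [:1, 1:] ^ (d - i))) x =
        a i * ((-x) ^ i * (- 1 - x) ^ (d - i))"
      by (simp add: algebra_simps)
  qed simp
  also have "\<dots> \<ge> 0" using a assms(2) by (intro sum_nonneg mult_nonneg_nonneg zero_le_power) auto
  finally show ?thesis .
qed

lemma not_magic_positive_even:
  "even d \<Longrightarrow> x \<le> -1 \<Longrightarrow> poly p x < 0 \<Longrightarrow> \<not> magic_positive d p"
  using magic_positive_sign[of d p x] by auto

lemma not_magic_positive_odd:
  "odd d \<Longrightarrow> x \<le> -1 \<Longrightarrow> poly p x > 0 \<Longrightarrow> \<not> magic_positive d p"
  using magic_positive_sign[of d p x] by auto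

lemma magic_positive_coeffs:
  assumes "magic_positive d p"
  obtains a :: "nat \<Rightarrow> real" where "\<And>i. i \<le> d \<Longrightarrow> a i \<ge> 0"
    "\<And>k. k \<le> d \<Longrightarrow> coeff p k = (\<Sum>i\<le>k. a i * real ((d - i) choose (k - i)))"
proof -
  obtain a where a: "\<And>i. i \<le> d \<Longrightarrow> a i \<ge> 0"
    and p: "p = (\<Sum>i\<le>d. smult (a i) ([:0, 1:] ^ i * [:1, 1:] ^ (d - i)))"
    using assms(1) by (auto simp: magic_positive_def)
  have term_coeff: "coeff ([:0, 1:] ^ i * [:1, 1:] ^ (d - i) :: real poly) k =
      (if i \<le> k then real ((d - i) choose (k - i)) else 0)" if "k \<le> d" for i k
  proof -
    have "[:0, 1:] ^ i = (monom 1 i :: real poly)" by (simp add: monom_altdef)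
    then show ?thesis using that by (simp add: coeff_monom_mult coeff_linear_poly_power not_less)
  qed
  have "coeff p k = (\<Sum>i\<le>k. a i * real ((d - i) choose (k - i)))" if "k \<le> d" for k
    unfolding p coeff_sum coeff_smult term_coeff[OF that]
    using that by (intro sum.mono_neutral_cong_right) auto
  with a show ?thesis by (rule that)
qed

text \<open>With these four rules the simplifier expands the polynomials for explicit \<open>m\<close> factor by factor,
keeping numerals instead of unary successors.\<close>
lemma pochhammer_linear_poly_numeral:
  "pochhammer [:b, c:] (numeral k) =
     pochhammer [:b, c:] (pred_numeral k) * [:b + of_nat (pred_numeral k), c:]"
  by (simp add: numeral_eq_Suc pochhammer_Suc of_nat_poly)

lemma sum_atMost_numeral: "(\<Sum>j\<le>numeral n. f j) = (\<Sum>j\<le>pred_numeral n. f j) + f (numeral n)"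
  by (simp add: numeral_eq_Suc)

lemma binomial_numeral:
  "numeral n choose numeral k = (pred_numeral n choose pred_numeral k) + (pred_numeral n choose numeral k)"
  by (simp add: numeral_eq_Suc)

lemma power_numeral_rec: "x ^ numeral n = x * x ^ pred_numeral n"
  by (simp add: numeral_eq_Suc)

text \<open>The matrix that takes the coefficients in the basis \<open>t ^ i * (1 + t) ^ (d - i)\<close> to the ordinary
coefficients is inverted by inserting alternating signs.\<close>
lemma alternating_binomial_product_sum:
  assumes "i \<le> k" "k \<le> d"
  shows "(\<Sum>j=i..k. (-1) ^ (k - j) * real ((d - j) choose (k - j)) * real ((d - i) choose (j - i)))
    = (if i = k then 1 else 0)"
proof -
  define r where "r = k - i"
  have "(\<Sum>j=i..k. (-1) ^ (k - j) * real ((d - j) choose (k - j)) * real ((d - i) choose (j - i)))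
     = (\<Sum>l\<le>r. (-1) ^ (r - l) * real ((d - i - l) choose (r - l)) * real ((d - i) choose l))"
    using assms by (intro sum.reindex_bij_witness[of _ "\<lambda>l. l + i" "\<lambda>j. j - i"]) (auto simp: r_def)
  also have "\<dots> = (\<Sum>l\<le>r. (-1) ^ r * real ((d - i) choose r) * ((-1) ^ l * real (r choose l)))"
  proof (rule sum.cong)
    fix l assume l: "l \<in> {..r}"
    then have "((d - i) choose r) * (r choose l) = ((d - i) choose l) * ((d - i - l) choose (r - l))"
      using assms by (intro choose_mult) (auto simp: r_def)
    then have "real ((d - i) choose l) * real ((d - i - l) choose (r - l)) =
        real ((d - i) choose r) * real (r choose l)"
      by (metis of_nat_mult)
    moreover have "(-1) ^ (r - l) = ((-1) ^ r * (-1) ^ l :: real)"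
      using l by (simp add: minus_one_power_iff)
    ultimately show "(-1) ^ (r - l) * real ((d - i - l) choose (r - l)) * real ((d - i) choose l)
      = (-1) ^ r * real ((d - i) choose r) * ((-1) ^ l * real (r choose l))"
      by (simp only: mult_ac)
  qed simp
  also have "\<dots> = (-1) ^ r * real ((d - i) choose r) * (\<Sum>l\<le>r. (-1) ^ l * real (r choose l))"
    by (simp only: sum_distrib_left)
  also have "\<dots> = (if i = k then 1 else 0)"
    using choose_alternating_sum[of r, where 'a = real] assms by (auto simp: r_def)
  finally show ?thesis .
qed

text \<open>The sum recovers the coefficient of \<open>t ^ k * (1 + t) ^ (d - k)\<close> from the ordinary coefficients.\<close>
lemma magic_positive_imp_coeff_inequality:
  assumes "magic_positive d p" and k: "k \<le> d"
  shows "(\<Sum>j\<le>k. (-1) ^ (k - j) * real ((d - j) choose (k - j)) * coeff p j) \<ge> 0"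
proof -
  obtain a where a: "\<And>i. i \<le> d \<Longrightarrow> a i \<ge> 0" and
    c: "\<And>j. j \<le> d \<Longrightarrow> coeff p j = (\<Sum>i\<le>j. a i * real ((d - i) choose (j - i)))"
    using magic_positive_coeffs[OF assms(1)] by blast
  have "(\<Sum>j\<le>k. (-1) ^ (k - j) * real ((d - j) choose (k - j)) * coeff p j) =
      (\<Sum>j\<le>k. \<Sum>i\<le>j. a i * ((-1) ^ (k - j) * real ((d - j) choose (k - j)) * real ((d - i) choose (j - i))))"
    using k by (intro sum.cong) (auto simp: c sum_distrib_left mult_ac)
  also have "\<dots> = (\<Sum>i\<le>k. \<Sum>j=i..k.
      a i * ((-1) ^ (k - j) * real ((d - j) choose (k - j)) * real ((d - i) choose (j - i))))"
    unfolding sum.Sigma[OF finite_atMost ballI[OF finite_atMost]]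
      sum.Sigma[OF finite_atMost ballI[OF finite_atLeastAtMost]]
    by (rule sum.reindex_bij_witness[of _ "\<lambda>(i, j). (j, i)" "\<lambda>(j, i). (i, j)"]) auto
  also have "\<dots> = (\<Sum>i\<le>k. if i = k then a i else 0)"
    using alternating_binomial_product_sum[OF _ k]
    by (intro sum.cong) (auto simp flip: sum_distrib_left)
  also have "\<dots> = a k" by simp
  finally show ?thesis using a k by simp
qed

section \<open>The polynomials for n = 1, 2, 3\<close>

text \<open>The hypotheses say that exactly \<open>r\<close> of the factors \<open>x, x + 1, \<dots>\<close> are negative.\<close>
lemma pochhammer_sign:
  assumes "- real r < x" "x < 1 - real r" "r \<le> m"
  shows "(-1) ^ r * pochhammer x m > 0"
  using assms
proof (induction r arbitrary: x m)
  case 0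
  then show ?case by (simp add: pochhammer_pos)
next
  case (Suc r)
  then obtain k where m: "m = Suc k" and "r \<le> k" by (cases m) auto
  then have "(-1) ^ r * pochhammer (x + 1) k > 0" using Suc by simp
  moreover have "x < 0" using Suc.prems by simp
  ultimately have "(- x) * ((-1) ^ r * pochhammer (x + 1) k) > 0"
    by (simp only: mult_pos_pos neg_0_less_iff_less)
  also have "(- x) * ((-1) ^ r * pochhammer (x + 1) k) = (-1) ^ Suc r * pochhammer x m"
    by (simp add: m pochhammer_rec)
  finally show ?case .
qed

lemma pochhammer_neg_eq_0: "n < m \<Longrightarrow> x = - real n \<Longrightarrow> pochhammer x m = 0"
  by (simp add: pochhammer_of_nat_eq_0_iff)

text \<open>Each of the next three lemmas evaluates the polynomial at a rational point left of \<open>-1\<close>, where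
its sign contradicts the parity of \<open>m\<close>: one point in \<open>(-2, -1)\<close> and one in \<open>(-3, -2)\<close>, since
passing an integer flips the sign of \<open>pochhammer x m\<close>. For \<open>n \<ge> 2\<close> the points have denominator
\<open>3\<close>, so that for large enough \<open>m\<close> the products \<open>pochhammer\<close> of the other summands contain the
factor \<open>0\<close>.\<close>
lemma not_magic_positive_1:
  assumes "m \<ge> 3"
  shows "\<not> magic_positive m (ehrhart_formula m 1)"
proof (cases "even m")
  case True
  have "pochhammer (-1/2 :: real) m < 0" using pochhammer_sign[of 1 "-1/2" m] assms by simp
  then have "poly (ehrhart_formula m 1) (-3/2) < 0"
    using assms by (simp add: poly_ehrhart_formula divide_neg_pos pochhammer_0_left)
  then show ?thesis using True by (intro not_magic_positive_even) auto
next
  case False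
  have "pochhammer (-3/2 :: real) m > 0" using pochhammer_sign[of 2 "-3/2" m] assms by simp
  then have "poly (ehrhart_formula m 1) (-5/2) > 0"
    using assms by (simp add: poly_ehrhart_formula pochhammer_0_left)
  then show ?thesis using False by (intro not_magic_positive_odd) auto
qed

text \<open>The case \<open>m = 5\<close> is out of reach of the sign argument, since \<open>pochhammer (-6) 5\<close> contains no
factor \<open>0\<close>; there the coefficient of \<open>t ^ 3 * (1 + t) ^ 2\<close> is negative.\<close>
lemma not_magic_positive_2:
  assumes "m \<ge> 4"
  shows "\<not> magic_positive m (ehrhart_formula m 2)"
proof -
  consider "even m" | "odd m" "m \<ge> 7" | "m = 5"
  proof (cases "m \<ge> 7")
    case False
    then have "m \<in> {4, 5, 6}" using assms by auto
    then show ?thesis using that by auto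
  qed (use that in auto)
  then show ?thesis
  proof cases
    case 1
    have "pochhammer (-3 :: real) m = 0" using assms by (intro pochhammer_neg_eq_0[of 3]) auto
    moreover have "pochhammer (-4/3 :: real) m > 0" using pochhammer_sign[of 2 "-4/3" m] assms by simp
    ultimately have "poly (ehrhart_formula m 2) (-4/3) < 0"
      using assms by (simp add: poly_ehrhart_formula divide_neg_pos)
    then show ?thesis using 1 by (intro not_magic_positive_even) auto
  next
    case 2
    have "pochhammer (-6 :: real) m = 0" using 2 by (intro pochhammer_neg_eq_0[of 6]) auto
    moreover have "pochhammer (-7/3 :: real) m < 0" using pochhammer_sign[of 3 "-7/3" m] 2 by simp
    ultimately have "poly (ehrhart_formula m 2) (-7/3) > 0"
      using assms by (simp add: poly_ehrhart_formula mult_pos_neg divide_neg_pos)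
    then show ?thesis using 2 by (intro not_magic_positive_odd) auto
  next
    case 3
    have "(\<Sum>j\<le>3. (-1) ^ (3 - j) * real ((5 - j) choose (3 - j)) * coeff (ehrhart_formula 5 2) j) < 0"
      by (simp add: sum_atMost_numeral ehrhart_formula_def pochhammer_linear_poly_numeral fact_numeral coeff_pCons'
        binomial_numeral binomial_eq_0)
    then show ?thesis using magic_positive_imp_coeff_inequality[of 5 "ehrhart_formula 5 2" 3] 3 by force
  qed
qed

text \<open>The sign argument needs \<open>m \<ge> 9\<close> for odd and \<open>m \<ge> 14\<close> for even \<open>m\<close>. In the remaining cases the
coefficient of \<open>t ^ 4 * (1 + t) ^ (m - 4)\<close> is negative.\<close>
lemma not_magic_positive_3:
  assumes "m \<ge> 7"
  shows "\<not> magic_positive m (ehrhart_formula m 3)"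
proof -
  have last: "1 + real (m - 1) * x < 0" if "x \<le> -1" for x
  proof -
    have "real (m - 1) * x \<le> real (m - 1) * (-1)" using that by (intro mult_left_mono) auto
    then show ?thesis using assms by (simp add: of_nat_diff)
  qed
  have bin: "real (m choose 2) > 0" using assms by simp
  consider "odd m" "m \<ge> 9" | "even m" "m \<ge> 14" | "m \<in> {7, 8, 10, 12}"
  proof (cases "m \<ge> 14")
    case False
    then have "m \<in> {7, 8, 9, 10, 11, 12, 13}" using assms by auto
    then show ?thesis using that by auto
  qed (use that in auto)
  then show ?thesis
  proof cases
    case 1
    have "pochhammer (-7 :: real) m = 0" using 1 by (intro pochhammer_neg_eq_0[of 7]) auto
    moreover have "pochhammer (-4 :: real) m = 0" using 1 by (intro pochhammer_neg_eq_0[of 4]) auto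
    moreover have "pochhammer (-4/3 :: real) (m - 1) > 0"
      using pochhammer_sign[of 2 "-4/3" "m - 1"] 1 by simp
    then have "real (m choose 2) * pochhammer (-4/3) (m - 1) * (1 + real (m - 1) * (-4/3)) < 0"
      using bin last[of "-4/3"] by (intro mult_pos_neg mult_pos_pos) auto
    ultimately have "poly (ehrhart_formula m 3) (-4/3) > 0"
      unfolding poly_ehrhart_formula by (simp add: divide_neg_pos)
    then show ?thesis using 1 by (intro not_magic_positive_odd) auto
  next
    case 2
    have "pochhammer (-13 :: real) m = 0" using 2 by (intro pochhammer_neg_eq_0[of 13]) auto
    moreover have "pochhammer (-7 :: real) m = 0" using 2 by (intro pochhammer_neg_eq_0[of 7]) auto
    moreover have "pochhammer (-7/3 :: real) (m - 1) < 0"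
      using pochhammer_sign[of 3 "-7/3" "m - 1"] 2 by simp
    then have "real (m choose 2) * pochhammer (-7/3) (m - 1) * (1 + real (m - 1) * (-7/3)) > 0"
      using bin last[of "-7/3"] by (intro mult_neg_neg mult_pos_neg) auto
    ultimately have "poly (ehrhart_formula m 3) (-7/3) < 0"
      unfolding poly_ehrhart_formula by (simp add: divide_neg_pos)
    then show ?thesis using 2 by (intro not_magic_positive_even) auto
  next
    case 3
    then have "(\<Sum>j\<le>4. (-1) ^ (4 - j) * real ((m - j) choose (4 - j)) * coeff (ehrhart_formula m 3) j) < 0"
      by (auto simp: sum_atMost_numeral ehrhart_formula_def pochhammer_linear_poly_numeral fact_numeral coeff_pCons'
        binomial_numeral binomial_eq_0)
    then show ?thesis using magic_positive_imp_coeff_inequality[of m "ehrhart_formula m 3" 4] 3 by force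
  qed
qed

lemma magic_positive_5_3: "magic_positive 5 (ehrhart_formula 5 3)"
proof -
  define a :: "nat \<Rightarrow> real" where "a i = [1, 26/5, 451/30, 2779/120, 179/20, 1] ! i" for i :: nat
  have "ehrhart_formula 5 3 = (\<Sum>i\<le>5. smult (a i) ([:0, 1:] ^ i * [:1, 1:] ^ (5 - i)))"
    by (simp add: a_def ehrhart_formula_def pochhammer_linear_poly_numeral fact_numeral
        sum_atMost_numeral power_numeral_rec choose_two)
  moreover have "a i \<ge> 0" if "i \<le> 5" for i
    using that by (auto simp: a_def le_Suc_eq numeral_eq_Suc)
  ultimately show ?thesis unfolding magic_positive_def by blast
qed

lemma magic_positive_6_3: "magic_positive 6 (ehrhart_formula 6 3)"
proof -
  define a :: "nat \<Rightarrow> real" where "a i = [1, 26/5, 1933/120, 6601/240, 913/120, 6/5, 0] ! i" for i :: nat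
  have "ehrhart_formula 6 3 = (\<Sum>i\<le>6. smult (a i) ([:0, 1:] ^ i * [:1, 1:] ^ (6 - i)))"
    by (simp add: a_def ehrhart_formula_def pochhammer_linear_poly_numeral fact_numeral
        sum_atMost_numeral power_numeral_rec choose_two)
  moreover have "a i \<ge> 0" if "i \<le> 6" for i
    using that by (auto simp: a_def le_Suc_eq numeral_eq_Suc)
  ultimately show ?thesis unfolding magic_positive_def by blast
qed

theorem theorem1p6:
  shows "(CARD('m::finite) \<ge> 3 \<longrightarrow>
            \<not> ehrhart_magic_positive (partial_permutohedron 1 :: (real ^ 'm) set)) \<and>
         (CARD('m) \<ge> 4 \<longrightarrow>
            \<not> ehrhart_magic_positive (partial_permutohedron 2 :: (real ^ 'm) set)) \<and>
         (CARD('m) \<ge> 5 \<longrightarrow>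
            (ehrhart_magic_positive (partial_permutohedron 3 :: (real ^ 'm) set)
               \<longleftrightarrow> CARD('m) = 5 \<or> CARD('m) = 6)) \<and>
         (CARD('m) \<ge> 7 \<longrightarrow>
            \<not> ehrhart_magic_positive (partial_permutohedron 3 :: (real ^ 'm) set))"
proof -
  have "magic_positive CARD('m) (ehrhart_formula CARD('m) 3) \<longleftrightarrow> CARD('m) = 5 \<or> CARD('m) = 6"
    if "CARD('m) \<ge> 5"
  proof (cases "CARD('m) \<ge> 7")
    case True
    then show ?thesis using not_magic_positive_3[OF True] by simp
  next
    case False
    then have "CARD('m) = 5 \<or> CARD('m) = 6" using that by auto
    then show ?thesis using magic_positive_5_3 magic_positive_6_3 by auto
  qed
  then show ?thesis
    using not_magic_positive_1[of "CARD('m)"] not_magic_positive_2[of "CARD('m)"]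
      not_magic_positive_3[of "CARD('m)"]
    by (simp add: ehrhart_magic_positive_iff)
qed

end
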